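(* Let $v_1, \dots, v_m \in \mathbb{R}^d$ be a tight frame, i.e. $\sum_{i=1}^m v_i \otimes v_i = \mathrm{Id}_d$, such that $0$ lies in the interior of $\mathrm{conv}\{v_1, \dots, v_m\}$, put \[ C = \{x \in \mathbb{R}^d : \langle v_i, x\rangle \leq 1 \text{ for } i = 1, \dots, m\}, \] let $Q$ be a positive definite (self-adjoint) operator on $\mathbb{R}^d$, and let $S(C,Q) = \max_{x \in C}\langle Qx, x\rangle$. Then \[ S(C, Q)\, \mathrm{trace}\, Q^{-1} \;\geq\; \eta_{m,d}^2 \;\geq\; m^2 \ln^2 \frac{m}{m-d}. \] In particular, for $m = 2d$ this gives \[ S(C, Q)\, \mathrm{trace}\, Q^{-1} \geq 4 (\ln 2)^2 d^2. \] Consequently, the intersection of any $2d$ closed halfspaces in $\mathbb{R}^d$ each containing the Euclidean unit ball contains a point of Euclidean norm at least $\dfrac{\eta_{2d,d}}{\sqrt{2d}}$, and \[ \frac{\eta_{2d,d}}{\sqrt{2d}} \geq \sqrt{2}\, \ln 2\, \sqrt{d} > 0.98 \sqrt{d}. \]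
   Context: $\langle\cdot,\cdot\rangle$ is the Euclidean inner product on $\mathbb{R}^d$, $(v \otimes v)x = \langle v, x\rangle v$, and $\mathrm{Id}_d$ is the identity operator on $\mathbb{R}^d$. For integers $m > d \geq 1$, \[ \eta_{m,d} = m \sum_{k=1}^d \frac{1}{\sqrt{(m-k)(m-k+1)}}. \] The condition that $0$ is an interior point of the convex hull forces $m > d$. *)

theory Defs
  imports "HOL-Analysis.Analysis"
begin

definition eta :: "nat \<Rightarrow> nat \<Rightarrow> real" where
  "eta m d = real m *
     (\<Sum>k=1..d. 1 / sqrt ((real m - real k) * (real m - real k + 1)))"

definition self_tensor :: "'a::real_inner \<Rightarrow> 'a \<Rightarrow> 'a" where
  "self_tensor v x = (v \<bullet> x) *\<^sub>R v"

definition tight_frame :: "nat \<Rightarrow> (nat \<Rightarrow> 'a::real_inner) \<Rightarrow> bool" where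
  "tight_frame m v \<longleftrightarrow> (\<lambda>x. \<Sum>i=1..m. self_tensor (v i) x) = id"

definition frame_body :: "nat \<Rightarrow> (nat \<Rightarrow> 'a::real_inner) \<Rightarrow> 'a set" where
  "frame_body m v = {x. \<forall>i\<in>{1..m}. v i \<bullet> x \<le> 1}"

definition pos_def_operator :: "('a::euclidean_space \<Rightarrow> 'a) \<Rightarrow> bool" where
  "pos_def_operator Q \<longleftrightarrow>
     linear Q \<and> adjoint Q = Q \<and> (\<forall>x. x \<noteq> 0 \<longrightarrow> Q x \<bullet> x > 0)"

text \<open>The maximum of the quadratic form of \<open>Q\<close> over \<open>C\<close>, as a supremum; it has its intended
  meaning only where the supremum is attained, so attainment has to be asserted separately.\<close>

definition max_quad_form :: "'a::real_inner set \<Rightarrow> ('a \<Rightarrow> 'a) \<Rightarrow> real" where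
  "max_quad_form C Q = (SUP x\<in>C. Q x \<bullet> x)"

definition operator_trace :: "(real ^ 'n \<Rightarrow> real ^ 'n) \<Rightarrow> real" where
  "operator_trace T = trace (matrix T)"

definition closed_halfspace :: "'a::real_inner set \<Rightarrow> bool" where
  "closed_halfspace H \<longleftrightarrow> (\<exists>a b. a \<noteq> 0 \<and> H = {x. a \<bullet> x \<le> b})"

end

theory Submission
  imports Defs
begin

text \<open>
  Let \<open>d\<close> be the dimension and let \<open>q 1 \<ge> \<dots> \<ge> q d\<close> be the eigenvalues of \<open>Q\<close> with orthonormal eigenvectors
  \<open>u k\<close>.  The quantity behind the theorem is the slack vector \<open>b i = 1 - v i \<bullet> x\<close> of a point \<open>x\<close> of \<open>C\<close>.
  By tightness, \<open>\<parallel>b\<parallel>\<^sup>2 = m - 2 (s \<bullet> x) + \<parallel>x\<parallel>\<^sup>2\<close> with \<open>s = (\<Sum>i=1..m. v i)\<close>, while the entries of \<open>b\<close>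
  sum to \<open>m - s \<bullet> x\<close>.  A random point with mean \<open>0\<close> and at least \<open>k\<close> vanishing slacks therefore satisfies
  \<open>E \<parallel>x\<parallel>\<^sup>2 \<ge> m\<^sup>2 / (m - k) - m = m k / (m - k)\<close>
  (\<open>tight_points_norm_lower_bound\<close>).  Successive values of the right-hand side differ by
  \<open>m\<^sup>2 / ((m - k) (m - k + 1))\<close>, the square of the \<open>k\<close>-th summand of \<open>eta m d\<close>.

  To use this for all \<open>k\<close> at once, consider a martingale \<open>x\<^sub>0 = 0, x\<^sub>1, \<dots>, x\<^sub>d\<close> in which \<open>x\<^sub>k\<close> is a vertex
  of the section of \<open>C\<close> by \<open>V k = span {u 1, \<dots>, u k}\<close>.  Such a vertex has at least \<open>k\<close> tight constraints, and
  the constraints tight at \<open>x\<^sub>k\<close> leave free at most a line in \<open>V (k + 1)\<close>, along which one moves in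
  either direction up to the boundary of \<open>C\<close> (\<open>section_vertex_extend\<close>).  By the martingale property the
  projection of \<open>x\<^sub>d\<close> onto \<open>V k\<close> has mean squared norm at least that of \<open>x\<^sub>k\<close>.  Abel summation over the
  decreasing eigenvalues then gives \<open>E (Q x\<^sub>d \<bullet> x\<^sub>d) \<ge> (\<Sum>k=1..d. q k * m\<^sup>2 / ((m - k) (m - k + 1)))\<close>, and by
  Cauchy--Schwarz the product of this sum with \<open>trace Q\<^sup>-\<^sup>1 = (\<Sum>k=1..d. 1 / q k)\<close> is at least
  \<open>(eta m d)\<^sup>2\<close>.

  No probability enters the formal proof.  Only linear functionals of the increments have to vanish in the
  mean, so at every step the direction is chosen that keeps one suitable functional from decreasing
  (\<open>walk_certificate\<close>).

  The logarithmic bound compares \<open>eta\<close> term by term with a telescoping sum (\<open>eta_ge_ln\<close>).  The statement on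
  halfspaces follows by shrinking them to halfspaces \<open>n i \<bullet> x \<le> 1\<close> with unit normals.  If the normals do
  not span positively, the intersection is unbounded.  Otherwise the linear map \<open>T\<^sup>-\<^sup>1\<^sup>/\<^sup>2\<close> with
  \<open>T = (\<Sum>i. n i \<otimes> n i)\<close> makes the family tight, and the first part applied to \<open>Q = T\<^sup>-\<^sup>1\<close>, where
  \<open>trace Q\<^sup>-\<^sup>1 = trace T = 2 d\<close>, gives the required point (\<open>positively_spanning_tightening\<close>).
\<close>

section \<open>Orthonormal systems and the spectral theorem\<close>

definition orthonormal_upto :: "nat \<Rightarrow> (nat \<Rightarrow> 'a::euclidean_space) \<Rightarrow> bool" where
  "orthonormal_upto n u \<longleftrightarrow>
     (\<forall>i\<in>{1..n}. \<forall>k\<in>{1..n}. u i \<bullet> u k = (if i = k then 1 else 0))"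

text \<open>
  \<open>W\<close> meets the orthogonal complement of the \<open>v i\<close> only in \<open>0\<close>, so the two dimensions add up to at most
  \<open>DIM('a)\<close>.  This count serves three purposes below: enough constraints are tight at a vertex of a section, an orthonormal
  system can be continued, and a positively spanning family has more than \<open>DIM('a)\<close> members.
\<close>

lemma dim_le_card_if_annihilator_trivial:
  fixes W :: "'a::euclidean_space set" and v :: "nat \<Rightarrow> 'a"
  assumes W: "subspace W" and "finite I"
    and triv: "\<And>w. w \<in> W \<Longrightarrow> (\<And>i. i \<in> I \<Longrightarrow> v i \<bullet> w = 0) \<Longrightarrow> w = 0"
  shows "dim W \<le> card I"
proof -
  define S where "S = span (v ` I)"
  define N where "N = {y \<in> UNIV. \<forall>x\<in>S. orthogonal x y}"
  have sub: "subspace S" "subspace N"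
    by (simp add: S_def) (auto simp: N_def subspace_def orthogonal_def inner_right_distrib)
  have S: "dim S \<le> card I"
    using \<open>finite I\<close> unfolding S_def dim_span
    by (meson card_image_le dim_le_card' finite_imageI le_trans)
  have N: "dim N + dim S = DIM('a)"
    using dim_subspace_orthogonal_to_vectors[OF sub(1) subspace_UNIV] by (simp add: N_def dim_UNIV)
  have "W \<inter> N = {0}"
    using triv sub W by (auto simp: N_def S_def orthogonal_def span_base subspace_0)
  then have zero: "dim (W \<inter> N) = 0" by simp
  have "dim {x + y |x y. x \<in> W \<and> y \<in> N} = dim W + dim N"
    using dim_sums_Int[OF W sub(2)] by (simp only: zero add_0_right)
  moreover have "dim {x + y |x y. x \<in> W \<and> y \<in> N} \<le> DIM('a)" by (rule dim_subset_UNIV)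
  ultimately have "dim W + dim N \<le> DIM('a)" by (simp only:)
  with S N show ?thesis by linarith
qed

lemma orthonormal_upto_inj_on: "orthonormal_upto n u \<Longrightarrow> inj_on u {1..n}"
  unfolding orthonormal_upto_def inj_on_def by (metis zero_neq_one)

lemma orthonormal_upto_independent:
  assumes "orthonormal_upto n u" shows "independent (u ` {1..n})"
proof (rule pairwise_orthogonal_independent)
  show "pairwise orthogonal (u ` {1..n})"
    using assms by (auto simp: pairwise_def orthogonal_def orthonormal_upto_def)
  show "0 \<notin> u ` {1..n}"
    using assms unfolding orthonormal_upto_def by (metis image_iff inner_zero_left zero_neq_one)
qed

lemma orthonormal_upto_dim_span:
  assumes "orthonormal_upto n u" shows "dim (span (u ` {1..n})) = n"
  using orthonormal_upto_independent[OF assms] card_image[OF orthonormal_upto_inj_on[OF assms]]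
  by (simp add: dim_eq_card_independent)

lemma orthonormal_upto_span_expand:
  assumes on: "orthonormal_upto n u" and x: "x \<in> span (u ` {1..n})"
  shows "x = (\<Sum>i=1..n. (x \<bullet> u i) *\<^sub>R u i)"
proof -
  have "(\<Sum>b\<in>u ` {1..n}. (x \<bullet> b) *\<^sub>R b) = x"
  proof (rule orthonormal_basis_expand[OF _ _ x])
    show "pairwise orthogonal (u ` {1..n})"
      using on by (auto simp: pairwise_def orthogonal_def orthonormal_upto_def)
    show "norm b = 1" if "b \<in> u ` {1..n}" for b
      using that on by (auto simp: norm_eq_1 orthonormal_upto_def)
  qed simp
  then show ?thesis
    by (simp add: sum.reindex[OF orthonormal_upto_inj_on[OF on], unfolded o_def, simplified])
qed

lemma orthonormal_upto_basis_span:
  fixes u :: "nat \<Rightarrow> 'a::euclidean_space"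
  assumes on: "orthonormal_upto DIM('a) u"
  shows "x \<in> span (u ` {1..DIM('a)})"
  using orthonormal_upto_dim_span[OF on] by (metis dim_eq_full UNIV_I span_span)

text \<open>
  The sum is the squared norm of the projection \<open>P y\<close> onto the span, and for \<open>z\<close> in the span the
  left-hand side is the tangent of that convex function at \<open>z\<close>: the gap is \<open>\<parallel>P y - z\<parallel>\<^sup>2\<close>.
\<close>

lemma orthonormal_upto_tangent_minorant:
  fixes u :: "nat \<Rightarrow> 'a::euclidean_space"
  assumes on: "orthonormal_upto n u" and z: "z \<in> span (u ` {1..n})"
  shows "2 * (z \<bullet> y) - z \<bullet> z \<le> (\<Sum>i=1..n. (y \<bullet> u i)\<^sup>2)"
proof -
  have e: "z \<bullet> w = (\<Sum>i=1..n. (z \<bullet> u i) * (w \<bullet> u i))" for w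
    using arg_cong[OF orthonormal_upto_span_expand[OF on z], of "\<lambda>x. x \<bullet> w"]
    by (simp add: inner_sum_left inner_commute[of "u _" w])
  have "2 * (z \<bullet> y) - z \<bullet> z = (\<Sum>i=1..n. 2 * ((z \<bullet> u i) * (y \<bullet> u i)) - (z \<bullet> u i) * (z \<bullet> u i))"
    by (simp only: e[of y] e[of z] sum_subtractf sum_distrib_left)
  also have "\<dots> \<le> (\<Sum>i=1..n. (y \<bullet> u i)\<^sup>2)"
  proof (rule sum_mono)
    fix i
    show "2 * ((z \<bullet> u i) * (y \<bullet> u i)) - (z \<bullet> u i) * (z \<bullet> u i) \<le> (y \<bullet> u i)\<^sup>2"
      using zero_le_power2[of "y \<bullet> u i - z \<bullet> u i"] by (simp add: power2_eq_square algebra_simps)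
  qed
  finally show ?thesis .
qed

text \<open>
  The component \<open>h\<close> of \<open>Q u\<close> orthogonal to \<open>u\<close> lies in \<open>W\<close>.  Moving from \<open>u\<close> by \<open>t h\<close> changes the
  Rayleigh quotient by \<open>2 t \<parallel>h\<parallel>\<^sup>2\<close> to first order, so maximality forces \<open>h = 0\<close>.
\<close>

lemma rayleigh_maximiser_eigenvector:
  fixes Q :: "'a::euclidean_space \<Rightarrow> 'a"
  assumes lin: "linear Q" and sym: "\<And>x y. Q x \<bullet> y = x \<bullet> Q y"
    and W: "subspace W" and inv: "\<And>w. w \<in> W \<Longrightarrow> Q w \<in> W"
    and u: "u \<in> W" "norm u = 1"
    and max: "\<And>w. w \<in> W \<Longrightarrow> Q w \<bullet> w \<le> (Q u \<bullet> u) * (w \<bullet> w)"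
  shows "Q u = (Q u \<bullet> u) *\<^sub>R u"
proof (rule ccontr)
  assume ne: "Q u \<noteq> (Q u \<bullet> u) *\<^sub>R u"
  define q where "q = Q u \<bullet> u"
  define h where "h = Q u - q *\<^sub>R u"
  have uu: "u \<bullet> u = 1" using u(2) by (simp add: norm_eq_1)
  have hu: "h \<bullet> u = 0" by (simp add: h_def inner_diff_left uu q_def)
  have hW: "h \<in> W" unfolding h_def by (intro subspace_diff subspace_scale W inv u)
  have hh: "h \<bullet> h > 0" using ne by (simp add: h_def q_def)
  have Quh: "Q u \<bullet> h = h \<bullet> h"
    using hu by (simp add: h_def inner_diff_left inner_diff_right inner_commute)
  define K where "K = q * (h \<bullet> h) - Q h \<bullet> h"
  have K0: "K \<ge> 0" using max[OF hW] by (simp add: K_def q_def)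
  have ineq: "2 * t * (h \<bullet> h) \<le> t\<^sup>2 * K" for t
  proof -
    have "u + t *\<^sub>R h \<in> W" by (intro subspace_add subspace_scale W u hW)
    from max[OF this]
    have le: "Q (u + t *\<^sub>R h) \<bullet> (u + t *\<^sub>R h) \<le> q * ((u + t *\<^sub>R h) \<bullet> (u + t *\<^sub>R h))"
      by (simp only: q_def)
    have "(u + t *\<^sub>R h) \<bullet> (u + t *\<^sub>R h) = 1 + t\<^sup>2 * (h \<bullet> h)"
      using uu hu by (simp add: inner_add_left inner_add_right inner_commute[of u h] power2_eq_square)
    moreover have "Q h \<bullet> u = h \<bullet> h" using Quh by (simp only: sym[of h u] inner_commute[of h "Q u"])
    then have "Q (u + t *\<^sub>R h) \<bullet> (u + t *\<^sub>R h) = q + 2 * t * (h \<bullet> h) + t\<^sup>2 * (Q h \<bullet> h)"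
      using Quh by (simp add: linear_add[OF lin] linear_scale[OF lin] inner_add_left inner_add_right
          q_def power2_eq_square distrib_left)
    ultimately show ?thesis using le by (simp add: K_def algebra_simps)
  qed
  \<comment> \<open>small enough for the linear term of \<open>ineq\<close> to win; adding \<open>1\<close> keeps the denominator positive\<close>
  define t where "t = h \<bullet> h / (K + 1)"
  have t: "t > 0" "t * (K + 1) = h \<bullet> h" using hh K0 by (simp_all add: t_def)
  have "t * (2 * (h \<bullet> h)) \<le> t * (t * K)" using ineq[of t] by (simp add: power2_eq_square mult_ac)
  then have "2 * (h \<bullet> h) \<le> t * K" using t(1) by (rule mult_left_le_imp_le)
  then show False using t hh by (simp add: distrib_left)
qed

lemma rayleigh_maximiser_exists:
  fixes Q :: "'a::euclidean_space \<Rightarrow> 'a"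
  assumes lin: "linear Q" and W: "subspace W" and z: "z \<in> W" "z \<noteq> 0"
  obtains u where "u \<in> W" "norm u = 1" "\<And>w. w \<in> W \<Longrightarrow> Q w \<bullet> w \<le> (Q u \<bullet> u) * (w \<bullet> w)"
proof -
  have "compact (sphere 0 1 \<inter> W)" using closed_subspace[OF W] by (intro compact_Int_closed) auto
  moreover have "z /\<^sub>R norm z \<in> sphere 0 1 \<inter> W" using z W by (simp add: subspace_scale)
  moreover have "continuous_on (sphere 0 1 \<inter> W) (\<lambda>x. Q x \<bullet> x)"
    by (intro continuous_intros linear_continuous_on) (simp add: lin linear_conv_bounded_linear[symmetric])
  ultimately obtain u where u: "u \<in> sphere 0 1 \<inter> W"
    and max: "\<And>y. y \<in> sphere 0 1 \<inter> W \<Longrightarrow> Q y \<bullet> y \<le> Q u \<bullet> u"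
    using continuous_attains_sup[of "sphere 0 1 \<inter> W" "\<lambda>x. Q x \<bullet> x"] by blast
  have "Q w \<bullet> w \<le> (Q u \<bullet> u) * (w \<bullet> w)" if w: "w \<in> W" for w
  proof (cases "w = 0")
    case False
    have "Q (w /\<^sub>R norm w) \<bullet> (w /\<^sub>R norm w) \<le> Q u \<bullet> u"
      using w W False by (intro max) (simp add: subspace_scale)
    then show ?thesis
      using False by (simp add: linear_scale[OF lin] dot_square_norm power2_eq_square field_simps)
  qed (simp add: linear_0[OF lin])
  with u that show ?thesis by auto
qed

text \<open>
  The spectral theorem, with the eigenvalues in decreasing order.  Each new eigenvector maximises the
  Rayleigh quotient on the orthogonal complement of the previous ones, and the maxima decrease because
  the complements shrink.
\<close>

theorem self_adjoint_sorted_eigenbasis: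
  fixes Q :: "'a::euclidean_space \<Rightarrow> 'a"
  assumes lin: "linear Q" and sym: "\<And>x y. Q x \<bullet> y = x \<bullet> Q y"
  obtains u q where "orthonormal_upto DIM('a) u"
    and "\<And>i. i \<in> {1..DIM('a)} \<Longrightarrow> Q (u i) = q i *\<^sub>R u i"
    and "\<And>i. 1 \<le> i \<Longrightarrow> i < DIM('a) \<Longrightarrow> q (Suc i) \<le> (q i :: real)"
proof -
  have "\<exists>u q. orthonormal_upto n u \<and> (\<forall>i\<in>{1..n}. Q (u i) = q i *\<^sub>R u i)
      \<and> (\<forall>i\<in>{1..n}. \<forall>w. (\<forall>l\<in>{1..<i}. u l \<bullet> w = 0) \<longrightarrow> Q w \<bullet> w \<le> q i * (w \<bullet> w))"
    if "n \<le> DIM('a)" for n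
    using that
  proof (induction n)
    case 0
    show ?case by (simp add: orthonormal_upto_def)
  next
    case (Suc n)
    then have "n \<le> DIM('a)" by simp
    from Suc.IH[OF this] obtain u q where on: "orthonormal_upto n u"
      and eig: "\<And>i. i \<in> {1..n} \<Longrightarrow> Q (u i) = q i *\<^sub>R u i"
      and mx: "\<And>i w. i \<in> {1..n} \<Longrightarrow> (\<forall>l\<in>{1..<i}. u l \<bullet> w = 0) \<Longrightarrow>
                  Q w \<bullet> w \<le> q i * (w \<bullet> w)"
      by blast
    define W where "W = {w. \<forall>l\<in>{1..n}. u l \<bullet> w = 0}"
    have W: "subspace W" by (auto simp: W_def subspace_def inner_right_distrib)
    have "\<exists>z\<in>W. z \<noteq> 0"
    proof (rule ccontr)
      assume "\<not> ?thesis"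
      then have triv: "w = 0" if "\<And>l. l \<in> {1..n} \<Longrightarrow> u l \<bullet> w = 0" for w
        using that unfolding W_def by blast
      have "dim (UNIV :: 'a set) \<le> card {1..n}"
        by (intro dim_le_card_if_annihilator_trivial[where v = u] triv) auto
      then show False using Suc.prems by (simp add: dim_UNIV)
    qed
    then obtain z where z: "z \<in> W" "z \<noteq> 0" by blast
    obtain e where e: "e \<in> W" "norm e = 1"
      and emax: "\<And>w. w \<in> W \<Longrightarrow> Q w \<bullet> w \<le> (Q e \<bullet> e) * (w \<bullet> w)"
      using rayleigh_maximiser_exists[OF lin W z] by metis
    have inv: "Q w \<in> W" if w: "w \<in> W" for w
    proof -
      have "u l \<bullet> Q w = 0" if l: "l \<in> {1..n}" for l
      proof -
        have "u l \<bullet> Q w = Q (u l) \<bullet> w" by (simp only: sym)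
        also have "\<dots> = q l * (u l \<bullet> w)" using eig[OF l] by simp
        finally show ?thesis using w l by (simp add: W_def)
      qed
      then show ?thesis by (simp add: W_def)
    qed
    have eige: "Q e = (Q e \<bullet> e) *\<^sub>R e"
      by (rule rayleigh_maximiser_eigenvector[OF lin sym W inv e emax])
    define u' where "u' = u(Suc n := e)"
    define q' where "q' = q(Suc n := Q e \<bullet> e)"
    have old: "u' i = u i" "q' i = q i" if "i \<in> {1..n}" for i
      using that by (auto simp: u'_def q'_def)
    have new: "u' (Suc n) = e" "q' (Suc n) = Q e \<bullet> e" by (simp_all add: u'_def q'_def)
    have ee: "e \<bullet> e = 1" using e(2) by (simp add: norm_eq_1)
    have ue: "u l \<bullet> e = 0" "e \<bullet> u l = 0" if "l \<in> {1..n}" for l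
      using e(1) that by (auto simp: W_def inner_commute)
    have ins: "{1..Suc n} = insert (Suc n) {1..n}" by auto
    have "orthonormal_upto (Suc n) u'"
      using on ee ue unfolding orthonormal_upto_def ins by (auto simp: old new)
    moreover have "Q (u' i) = q' i *\<^sub>R u' i" if i: "i \<in> {1..Suc n}" for i
    proof (cases "i = Suc n")
      case True
      then show ?thesis using eige by (simp only: new)
    next
      case False
      then have "i \<in> {1..n}" using i by auto
      then show ?thesis using eig by (simp add: old)
    qed
    moreover have "Q w \<bullet> w \<le> q' i * (w \<bullet> w)"
      if i: "i \<in> {1..Suc n}" and w: "\<forall>l\<in>{1..<i}. u' l \<bullet> w = 0" for i w
    proof -
      have w': "u l \<bullet> w = 0" if l: "l \<in> {1..<i}" for l
      proof -
        have "l \<in> {1..n}" using l i by auto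
        then show ?thesis using w l by (simp add: old(1)[symmetric])
      qed
      show ?thesis
      proof (cases "i = Suc n")
        case True
        then have "w \<in> W" using w' by (auto simp: W_def)
        then show ?thesis using emax True by (simp add: new)
      next
        case False
        then have "i \<in> {1..n}" using i by auto
        then show ?thesis using w' mx by (simp add: old)
      qed
    qed
    ultimately show ?case by (intro exI[of _ u'] exI[of _ q']) blast
  qed
  from this[OF order_refl] obtain u q where on: "orthonormal_upto DIM('a) u"
    and eig: "\<And>i. i \<in> {1..DIM('a)} \<Longrightarrow> Q (u i) = q i *\<^sub>R u i"
    and mx: "\<And>i w. i \<in> {1..DIM('a)} \<Longrightarrow> (\<forall>l\<in>{1..<i}. u l \<bullet> w = 0) \<Longrightarrow>
                  Q w \<bullet> w \<le> q i * (w \<bullet> w)"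
    by blast
  show ?thesis
  proof (rule that[OF on eig])
    fix i assume i: "1 \<le> i" "i < DIM('a)"
    have 1: "u (Suc i) \<bullet> u (Suc i) = 1" "\<forall>l\<in>{1..<i}. u l \<bullet> u (Suc i) = 0"
      using on i by (auto simp: orthonormal_upto_def)
    show "q (Suc i) \<le> q i"
      using mx[of i "u (Suc i)"] eig[of "Suc i"] i 1 by simp
  qed
qed

section \<open>Vertices of sections of the frame body\<close>

definition tight_set :: "nat \<Rightarrow> (nat \<Rightarrow> 'a::real_inner) \<Rightarrow> 'a \<Rightarrow> nat set" where
  "tight_set m v x = {i\<in>{1..m}. v i \<bullet> x = 1}"

text \<open>
  For a subspace \<open>W\<close> this says that \<open>x\<close> is a vertex of the section of the frame body by \<open>W\<close>, in the
  algebraic form in which the walk uses it: no direction in \<open>W\<close> keeps all constraints tight that are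
  tight at \<open>x\<close>.
\<close>

definition section_vertex :: "nat \<Rightarrow> (nat \<Rightarrow> 'a::real_inner) \<Rightarrow> 'a set \<Rightarrow> 'a \<Rightarrow> bool" where
  "section_vertex m v W x \<longleftrightarrow> x \<in> W \<and> x \<in> frame_body m v \<and>
     (\<forall>w\<in>W. (\<forall>i\<in>tight_set m v x. v i \<bullet> w = 0) \<longrightarrow> w = 0)"

text \<open>
  The form in which the walk uses that \<open>0\<close> is interior to the convex hull: every ray leaves the frame
  body.  It is visibly preserved by an invertible linear change of coordinates, and its failure
  exhibits a ray inside the frame body.
\<close>

definition positively_spanning :: "nat \<Rightarrow> (nat \<Rightarrow> 'a::real_inner) \<Rightarrow> bool" where
  "positively_spanning m v \<longleftrightarrow> (\<forall>a. a \<noteq> 0 \<longrightarrow> (\<exists>i\<in>{1..m}. v i \<bullet> a > 0))"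

lemma finite_tight_set [simp]: "finite (tight_set m v x)"
  by (simp add: tight_set_def)

lemma section_vertex_dim_le_card:
  fixes v :: "nat \<Rightarrow> 'a::euclidean_space"
  assumes "section_vertex m v W x" and "subspace W"
  shows "dim W \<le> card (tight_set m v x)"
  using assms by (intro dim_le_card_if_annihilator_trivial[where v = v]) (auto simp: section_vertex_def)

text \<open>
  The first constraint to become tight along the ray is the one minimising slack over speed.
\<close>

lemma ray_hits_facet:
  fixes v :: "nat \<Rightarrow> 'a::real_inner"
  assumes x: "x \<in> frame_body m v" and pos: "\<exists>i\<in>{1..m}. v i \<bullet> w > 0"
  obtains t j where "t \<ge> 0" "x + t *\<^sub>R w \<in> frame_body m v"
    "j \<in> tight_set m v (x + t *\<^sub>R w)" "v j \<bullet> w > 0"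
proof -
  define J where "J = {i\<in>{1..m}. v i \<bullet> w > 0}"
  have J: "finite J" "J \<noteq> {}" using pos by (auto simp: J_def)
  define f where "f i = (1 - v i \<bullet> x) / (v i \<bullet> w)" for i
  obtain j where j: "j \<in> J" and jmin: "\<And>i. i \<in> J \<Longrightarrow> f j \<le> f i"
    using J by (metis arg_min_if_finite(1) arg_min_least)
  have wj: "v j \<bullet> w > 0" and jm: "j \<in> {1..m}" using j by (auto simp: J_def)
  have t0: "f j \<ge> 0" using x wj jm by (simp add: f_def frame_body_def)
  show ?thesis
  proof
    show "0 \<le> f j" by (rule t0)
    show "x + f j *\<^sub>R w \<in> frame_body m v"
      unfolding frame_body_def
    proof safe
      fix i assume i: "i \<in> {1..m}"
      have xi: "v i \<bullet> x \<le> 1" using x i by (simp add: frame_body_def)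
      show "v i \<bullet> (x + f j *\<^sub>R w) \<le> 1"
      proof (cases "v i \<bullet> w > 0")
        case True
        then have "f j \<le> f i" using i by (intro jmin) (simp add: J_def)
        then have "f j * (v i \<bullet> w) \<le> 1 - v i \<bullet> x"
          using True by (simp add: f_def[of i] pos_le_divide_eq)
        then show ?thesis by (simp add: inner_add_right)
      next
        case False
        then have "f j * (v i \<bullet> w) \<le> 0" using t0 by (simp add: mult_nonneg_nonpos)
        then show ?thesis using xi by (simp add: inner_add_right)
      qed
    qed
    show "j \<in> tight_set m v (x + f j *\<^sub>R w)"
      using wj jm by (simp add: tight_set_def inner_add_right f_def)
    show "v j \<bullet> w > 0" by (rule wj)
  qed
qed

text \<open>
  One step of the walk.  If \<open>x\<close> is not yet a vertex of the larger section, the directions in the larger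
  subspace that keep the tight constraints tight form a line, because they meet \<open>span B\<close> only in \<open>0\<close>.
  Both orientations of this line lead to a vertex, so the orientation can be chosen to make any one
  prescribed linear functional \<open>a\<close> nondecreasing.  This choice takes the place of a random step of mean
  zero.
\<close>

lemma section_vertex_extend:
  fixes v :: "nat \<Rightarrow> 'a::euclidean_space"
  assumes ps: "positively_spanning m v" and x: "section_vertex m v (span B) x"
  obtains y where "section_vertex m v (span (insert e B)) y" "a \<bullet> (y - x) \<ge> 0"
proof (cases "section_vertex m v (span (insert e B)) x")
  case True
  then show ?thesis using that[of x] by simp
next
  case False
  have xW: "x \<in> span (insert e B)" "x \<in> frame_body m v"
    using x span_mono[of B "insert e B"] by (auto simp: section_vertex_def)
  with False obtain w0 where w0: "w0 \<in> span (insert e B)" "w0 \<noteq> 0"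
    "\<And>i. i \<in> tight_set m v x \<Longrightarrow> v i \<bullet> w0 = 0"
    unfolding section_vertex_def by blast
  define w where "w = (if a \<bullet> w0 \<ge> 0 then w0 else - w0)"
  have w: "w \<in> span (insert e B)" "w \<noteq> 0" "a \<bullet> w \<ge> 0"
    and w_tight: "\<And>i. i \<in> tight_set m v x \<Longrightarrow> v i \<bullet> w = 0"
    using w0 by (auto simp: w_def span_neg)
  obtain c where c: "w - c *\<^sub>R e \<in> span B" using w(1) by (auto simp: span_breakdown_eq)
  have nB: "z = 0" if "z \<in> span B" "\<And>i. i \<in> tight_set m v x \<Longrightarrow> v i \<bullet> z = 0" for z
    using x that by (auto simp: section_vertex_def)
  have c0: "c \<noteq> 0" using nB[of w] w w_tight c by auto
  have "\<exists>i\<in>{1..m}. v i \<bullet> w > 0" using ps w(2) by (simp add: positively_spanning_def)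
  from ray_hits_facet[OF xW(2) this] obtain t j where t: "t \<ge> 0"
    and y: "x + t *\<^sub>R w \<in> frame_body m v" and j: "j \<in> tight_set m v (x + t *\<^sub>R w)" "v j \<bullet> w > 0" .
  define y where "y = x + t *\<^sub>R w"
  have mono: "tight_set m v x \<subseteq> tight_set m v y"
    using w_tight by (auto simp: tight_set_def y_def inner_add_right)
  \<comment> \<open>modulo \<open>span B\<close> every \<open>z\<close> is a multiple of \<open>w\<close>, and the new tight constraint \<open>j\<close> sees \<open>w\<close>\<close>
  have triv: "z = 0" if z: "z \<in> span (insert e B)" and z0: "\<And>i. i \<in> tight_set m v y \<Longrightarrow> v i \<bullet> z = 0" for z
  proof -
    obtain b where b: "z - b *\<^sub>R e \<in> span B" using z by (auto simp: span_breakdown_eq)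
    have "(z - b *\<^sub>R e) - (b / c) *\<^sub>R (w - c *\<^sub>R e) \<in> span B"
      by (intro span_diff span_scale b c)
    then have "z - (b / c) *\<^sub>R w \<in> span B" using c0 by (simp add: algebra_simps)
    moreover have "v i \<bullet> (z - (b / c) *\<^sub>R w) = 0" if "i \<in> tight_set m v x" for i
      using that mono z0 w_tight by (auto simp: inner_diff_right)
    ultimately have "z - (b / c) *\<^sub>R w = 0" by (rule nB)
    then have zw: "z = (b / c) *\<^sub>R w" by simp
    have "v j \<bullet> z = 0" using j(1) by (intro z0) (simp add: y_def)
    then have "b / c = 0" using j(2) zw by simp
    then show ?thesis using zw by simp
  qed
  show ?thesis
  proof (rule that)
    show "section_vertex m v (span (insert e B)) y"
      using y xW(1) w(1) triv by (auto simp: section_vertex_def y_def span_add span_scale)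
    show "a \<bullet> (y - x) \<ge> 0" using t w(3) by (simp add: y_def)
  qed
qed

lemma tight_frame_parseval:
  assumes "tight_frame m v"
  shows "(\<Sum>i=1..m. (v i \<bullet> x) * (v i \<bullet> y)) = x \<bullet> y"
proof -
  have "(\<Sum>i=1..m. self_tensor (v i) x) = x" using assms by (metis id_apply tight_frame_def)
  then have "(\<Sum>i=1..m. self_tensor (v i) x) \<bullet> y = x \<bullet> y" by simp
  then show ?thesis by (simp add: inner_sum_left self_tensor_def)
qed

text \<open>
  The slacks \<open>1 - v i \<bullet> x\<close> sum to \<open>m - s \<bullet> x\<close> with \<open>s = (\<Sum>i=1..m. v i)\<close>, and by Parseval their squares
  sum to \<open>m - 2 (s \<bullet> x) + \<parallel>x\<parallel>\<^sup>2\<close>.  At most \<open>m - k\<close> of them are nonzero, so the sum of squares is large.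
  Cauchy--Schwarz would give a bound quadratic in \<open>s \<bullet> x\<close>; its tangent at \<open>s \<bullet> x = 0\<close> is kept instead,
  since a bound affine in \<open>x\<close> can be summed along the walk.
\<close>

lemma tight_points_norm_lower_bound:
  fixes v :: "nat \<Rightarrow> 'a::euclidean_space"
  assumes tf: "tight_frame m v" and x: "x \<in> frame_body m v"
    and k: "k \<le> card (tight_set m v x)" "k < m"
  shows "x \<bullet> x \<ge> real m * real k / (real m - real k)
           - 2 * real k / (real m - real k) * ((\<Sum>i=1..m. v i) \<bullet> x)"
proof -
  \<comment> \<open>the mean of the nonzero slacks when \<open>s \<bullet> x = 0\<close> and exactly \<open>k\<close> constraints are tight\<close>
  define r where "r = real m / (real m - real k)"
  define N where "N = {1..m} - tight_set m v x"
  define s where "s = (\<Sum>i=1..m. v i) \<bullet> x"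
  have sub: "tight_set m v x \<subseteq> {1..m}" by (auto simp: tight_set_def)
  have r: "r * (real m - real k) = real m" using k(2) by (simp add: r_def)
  have sum1: "(\<Sum>i=1..m. 1 - v i \<bullet> x) = real m - s"
    by (simp add: sum_subtractf s_def inner_sum_left)
  have outside: "(\<Sum>i\<in>N. f (1 - v i \<bullet> x)) = (\<Sum>i=1..m. f (1 - v i \<bullet> x))" if "f 0 = 0" for f :: "real \<Rightarrow> real"
    using that unfolding N_def by (intro sum.mono_neutral_left) (auto simp: tight_set_def)
  have "(\<Sum>i=1..m. (1 - v i \<bullet> x)\<^sup>2) = (\<Sum>i=1..m. 1 - 2 * (v i \<bullet> x) + (v i \<bullet> x) * (v i \<bullet> x))"
    by (simp add: power2_eq_square algebra_simps)
  also have "\<dots> = real m - 2 * s + x \<bullet> x"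
    by (simp del: One_nat_def add: sum.distrib sum_subtractf sum_distrib_left[symmetric] tight_frame_parseval[OF tf]
        s_def inner_sum_left)
  finally have sq: "(\<Sum>i=1..m. (1 - v i \<bullet> x)\<^sup>2) = real m - 2 * s + x \<bullet> x" .
  have "real (card N) \<le> real m - real k"
    using k sub by (simp add: N_def card_Diff_subset of_nat_diff)
  then have cN: "r\<^sup>2 * real (card N) \<le> r * real m"
    using r by (metis mult_left_mono zero_le_power2 power2_eq_square mult.assoc)
  have "2 * r * (real m - s) - r * real m \<le> (\<Sum>i\<in>N. 2 * r * (1 - v i \<bullet> x) - r\<^sup>2)"
    using cN outside[of "\<lambda>b. b"] sum1
    by (simp add: sum_subtractf sum_distrib_left[symmetric] mult.commute)
  also have "\<dots> \<le> (\<Sum>i\<in>N. (1 - v i \<bullet> x)\<^sup>2)"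
  proof (rule sum_mono)
    fix i
    show "2 * r * (1 - v i \<bullet> x) - r\<^sup>2 \<le> (1 - v i \<bullet> x)\<^sup>2"
      using zero_le_power2[of "(1 - v i \<bullet> x) - r"] by (simp add: power2_eq_square algebra_simps)
  qed
  also have "\<dots> = real m - 2 * s + x \<bullet> x" using outside[of "\<lambda>b. b\<^sup>2"] sq by simp
  finally have "x \<bullet> x \<ge> (r - 1) * real m - 2 * (r - 1) * s" by (simp add: algebra_simps)
  moreover have "r - 1 = real k / (real m - real k)" using k(2) by (simp add: r_def field_simps)
  ultimately show ?thesis by (simp add: s_def mult_ac)
qed

section \<open>A walk through sections of increasing dimension\<close>

lemma abel_summation:
  fixes p a :: "nat \<Rightarrow> real"
  shows "(\<Sum>i=1..n. (p i - p (Suc i)) * (\<Sum>k=1..i. a k))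
           = (\<Sum>k=1..n. p k * a k) - p (Suc n) * (\<Sum>k=1..n. a k)"
  by (induction n) (simp_all add: algebra_simps)

text \<open>
  The \<open>k\<close>-th summand is the increment of \<open>m k / (m - k)\<close>, the squared norm that \<open>k\<close> tight constraints
  force when \<open>s \<bullet> x = 0\<close>.  It is also the square of the \<open>k\<close>-th summand of \<open>eta\<close>.
\<close>

lemma sum_gain_closed_form:
  assumes "n < m"
  shows "(\<Sum>k=1..n. (real m)\<^sup>2 / ((real m - real k) * (real m - real k + 1)))
           = real m * real n / (real m - real n)"
  using assms
proof (induction n)
  case (Suc n)
  define N where "N = real m - real n"
  have N: "N > 1" "real m - real (Suc n) = N - 1" "real n = real m - N" "real (Suc n) = real m - N + 1"
    using Suc.prems by (auto simp: N_def)
  have IH: "(\<Sum>k=1..n. (real m)\<^sup>2 / ((real m - real k) * (real m - real k + 1)))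
           = real m * (real m - N) / N" using Suc by (simp add: N_def)
  have "real m * (real m - N) / N + (real m)\<^sup>2 / ((N - 1) * (N - 1 + 1))
          = real m * (real m - N + 1) / (N - 1)"
    using N(1) by (simp add: divide_simps) (simp add: algebra_simps power2_eq_square)
  then show ?case
    by (simp only: sum.cl_ivl_Suc N IH) simp
qed simp

text \<open>
  The walk visits vertices \<open>x\<^sub>0 = 0, x\<^sub>1, \<dots>\<close> of the sections by the growing subspaces
  \<open>V i = span (u ` {1..i})\<close>.  Writing \<open>P i\<close> for the projection onto \<open>V i\<close>, the quantity to be made large
  at the final vertex is \<open>\<Sum>i. g i * \<parallel>P i y\<parallel>\<^sup>2\<close>.  Once \<open>x\<^sub>i\<close> is known, \<open>\<parallel>P i y\<parallel>\<^sup>2\<close> is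
  replaced by its tangent at \<open>x\<^sub>i\<close>; the function \<open>\<alpha> + \<beta> \<bullet> y\<close> is the sum of these tangents over the
  steps already made.  For the steps still to come, \<open>g i * (D i - c i * (s \<bullet> x))\<close> is what the slack
  estimate promises from the present position.  The total of both is an affine function of the position,
  and orienting each step so that this function does not decrease preserves the last inequality of the
  conclusion.  After the step the slack estimate at the new vertex lets its tangent, whose value there
  is its squared norm, replace the promise for that step.
\<close>

lemma walk_certificate:
  fixes v u :: "nat \<Rightarrow> 'a::euclidean_space" and g :: "nat \<Rightarrow> real"
  assumes tf: "tight_frame m v" and ps: "positively_spanning m v" and m: "DIM('a) < m"
    and on: "orthonormal_upto DIM('a) u" and g: "\<And>i. g i \<ge> 0"
  defines "s \<equiv> \<Sum>i=1..m. v i"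
    and "D \<equiv> \<lambda>i. real m * real i / (real m - real i)"
    and "c \<equiv> \<lambda>i. 2 * real i / (real m - real i)"
  assumes n: "n \<le> DIM('a)"
  shows "\<exists>\<alpha> \<beta> x. section_vertex m v (span (u ` {1..n})) x
      \<and> (\<forall>y. \<alpha> + \<beta> \<bullet> y \<le> (\<Sum>i=1..n. g i * (\<Sum>k=1..i. (y \<bullet> u k)\<^sup>2)))
      \<and> (\<Sum>i=1..DIM('a). g i * D i)
            \<le> \<alpha> + \<beta> \<bullet> x + (\<Sum>i=Suc n..DIM('a). g i * (D i - c i * (s \<bullet> x)))"
  using n
proof (induction n)
  case 0
  have "section_vertex m v (span (u ` {1..0})) 0"
    by (simp add: section_vertex_def frame_body_def)
  then show ?case by (intro exI[of _ 0]) simp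
next
  case (Suc n)
  define d where "d = DIM('a)"
  have nd: "Suc n \<le> d" using Suc.prems by (simp add: d_def)
  obtain \<alpha> \<beta> x where x: "section_vertex m v (span (u ` {1..n})) x"
    and minor: "\<And>y. \<alpha> + \<beta> \<bullet> y \<le> (\<Sum>i=1..n. g i * (\<Sum>k=1..i. (y \<bullet> u k)\<^sup>2))"
    and val: "(\<Sum>i=1..d. g i * D i)
            \<le> \<alpha> + \<beta> \<bullet> x + (\<Sum>i=Suc n..d. g i * (D i - c i * (s \<bullet> x)))"
    using Suc.IH Suc.prems unfolding d_def by (meson Suc_leD)
  \<comment> \<open>the linear part of the total as a function of the position\<close>
  define a where "a = \<beta> - (\<Sum>i=Suc n..d. g i * c i) *\<^sub>R s"
  obtain y where y0: "section_vertex m v (span (insert (u (Suc n)) (u ` {1..n}))) y"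
    and ay: "a \<bullet> (y - x) \<ge> 0"
    using section_vertex_extend[OF ps x] .
  have ins: "insert (u (Suc n)) (u ` {1..n}) = u ` {1..Suc n}"
    by (auto simp: image_iff atLeastAtMostSuc_conv)
  have y: "section_vertex m v (span (u ` {1..Suc n})) y" using y0 by (simp only: ins)
  have on': "orthonormal_upto (Suc n) u" using on nd by (auto simp: orthonormal_upto_def d_def)
  have "Suc n \<le> card (tight_set m v y)"
    using section_vertex_dim_le_card[OF y subspace_span] orthonormal_upto_dim_span[OF on'] by simp
  moreover have "y \<in> frame_body m v" "y \<in> span (u ` {1..Suc n})" using y by (auto simp: section_vertex_def)
  ultimately have yy: "y \<bullet> y \<ge> D (Suc n) - c (Suc n) * (s \<bullet> y)"
    using tight_points_norm_lower_bound[OF tf, of y "Suc n"] m nd unfolding D_def c_def s_def d_def by simp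
  define \<alpha>' where "\<alpha>' = \<alpha> - g (Suc n) * (y \<bullet> y)"
  define \<beta>' where "\<beta>' = \<beta> + (2 * g (Suc n)) *\<^sub>R y"
  have "\<alpha>' + \<beta>' \<bullet> z \<le> (\<Sum>i=1..Suc n. g i * (\<Sum>k=1..i. (z \<bullet> u k)\<^sup>2))" for z
  proof -
    have "g (Suc n) * (2 * (y \<bullet> z) - y \<bullet> y) \<le> g (Suc n) * (\<Sum>k=1..Suc n. (z \<bullet> u k)\<^sup>2)"
      using \<open>y \<in> span _\<close> by (intro mult_left_mono g orthonormal_upto_tangent_minorant[OF on'])
    moreover have "\<alpha>' + \<beta>' \<bullet> z = (\<alpha> + \<beta> \<bullet> z) + g (Suc n) * (2 * (y \<bullet> z) - y \<bullet> y)"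
      by (simp add: \<alpha>'_def \<beta>'_def inner_add_left algebra_simps)
    moreover have "(\<Sum>i=1..Suc n. g i * (\<Sum>k=1..i. (z \<bullet> u k)\<^sup>2))
        = (\<Sum>i=1..n. g i * (\<Sum>k=1..i. (z \<bullet> u k)\<^sup>2)) + g (Suc n) * (\<Sum>k=1..Suc n. (z \<bullet> u k)\<^sup>2)"
      by (rule sum.cl_ivl_Suc[THEN trans]) simp
    ultimately show ?thesis using minor[of z] by linarith
  qed
  moreover have "(\<Sum>i=1..d. g i * D i)
       \<le> \<alpha>' + \<beta>' \<bullet> y + (\<Sum>i=Suc (Suc n)..d. g i * (D i - c i * (s \<bullet> y)))"
  proof -
    have split: "(\<Sum>i=Suc n..d. g i * (D i - c i * b))
        = (\<Sum>i=Suc n..d. g i * D i) - (\<Sum>i=Suc n..d. g i * c i) * b" for b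
      by (simp add: sum_subtractf sum_distrib_right right_diff_distrib mult.assoc)
    have "(\<Sum>i=1..d. g i * D i) \<le> \<alpha> + \<beta> \<bullet> x + (\<Sum>i=Suc n..d. g i * (D i - c i * (s \<bullet> x))) + a \<bullet> (y - x)"
      using val ay by linarith
    also have "\<dots> = \<alpha> + \<beta> \<bullet> y + (\<Sum>i=Suc n..d. g i * (D i - c i * (s \<bullet> y)))"
      unfolding split by (simp add: a_def inner_diff_left inner_diff_right algebra_simps)
    also have "\<dots> = \<alpha> + \<beta> \<bullet> y + g (Suc n) * (D (Suc n) - c (Suc n) * (s \<bullet> y))
         + (\<Sum>i=Suc (Suc n)..d. g i * (D i - c i * (s \<bullet> y)))"
      using nd by (simp add: sum.atLeast_Suc_atMost[of "Suc n" d])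
    also have "\<dots> \<le> \<alpha> + \<beta> \<bullet> y + g (Suc n) * (y \<bullet> y)
         + (\<Sum>i=Suc (Suc n)..d. g i * (D i - c i * (s \<bullet> y)))"
      using mult_left_mono[OF yy g] by simp
    also have "\<alpha> + \<beta> \<bullet> y + g (Suc n) * (y \<bullet> y) = \<alpha>' + \<beta>' \<bullet> y"
      by (simp add: \<alpha>'_def \<beta>'_def inner_add_left algebra_simps)
    finally show ?thesis .
  qed
  ultimately show ?case using y unfolding d_def by blast
qed

text \<open>
  Abel summation with the nonnegative weights \<open>q i - q (i + 1)\<close> turns the diagonal form into a
  combination of the squared norms of the projections onto \<open>span (u ` {1..i})\<close>.  This is why the
  coefficients have to decrease.  The same summation on the other side recovers the coefficients \<open>q k\<close>
  from the closed form of the partial sums.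
\<close>

lemma diagonal_form_lower_bound:
  fixes v u :: "nat \<Rightarrow> 'a::euclidean_space" and q :: "nat \<Rightarrow> real"
  assumes tf: "tight_frame m v" and ps: "positively_spanning m v" and m: "DIM('a) < m"
    and on: "orthonormal_upto DIM('a) u"
    and dec: "\<And>i. 1 \<le> i \<Longrightarrow> i < DIM('a) \<Longrightarrow> q (Suc i) \<le> q i"
    and pos: "\<And>i. i \<in> {1..DIM('a)} \<Longrightarrow> q i \<ge> 0"
  shows "\<exists>x\<in>frame_body m v.
      (\<Sum>k=1..DIM('a). q k * ((real m)\<^sup>2 / ((real m - real k) * (real m - real k + 1))))
        \<le> (\<Sum>k=1..DIM('a). q k * (x \<bullet> u k)\<^sup>2)"
proof -
  define d where "d = DIM('a)"
  \<comment> \<open>cut off after \<open>d\<close>, so that the last weight is \<open>q d\<close> and Abel summation has no boundary term\<close>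
  define p where "p i = (if i \<in> {1..d} then q i else 0)" for i
  define g where "g i = (if i = 0 then 0 else p i - p (Suc i))" for i
  have g0: "g i \<ge> 0" for i
    using dec[of i] pos[of i] by (auto simp: g_def p_def d_def)
  have abel: "(\<Sum>i=1..d. g i * (\<Sum>k=1..i. a k)) = (\<Sum>k=1..d. q k * a k)" for a :: "nat \<Rightarrow> real"
  proof -
    have "(\<Sum>i=1..d. g i * (\<Sum>k=1..i. a k)) = (\<Sum>i=1..d. (p i - p (Suc i)) * (\<Sum>k=1..i. a k))"
      by (intro sum.cong) (auto simp: g_def)
    also have "\<dots> = (\<Sum>k=1..d. p k * a k)" unfolding abel_summation by (simp add: p_def[of "Suc d"])
    also have "\<dots> = (\<Sum>k=1..d. q k * a k)" by (intro sum.cong) (auto simp: p_def)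
    finally show ?thesis .
  qed
  obtain \<alpha> \<beta> x where x: "section_vertex m v (span (u ` {1..d})) x"
    and minor: "\<And>y. \<alpha> + \<beta> \<bullet> y \<le> (\<Sum>i=1..d. g i * (\<Sum>k=1..i. (y \<bullet> u k)\<^sup>2))"
    and val: "(\<Sum>i=1..d. g i * (real m * real i / (real m - real i))) \<le> \<alpha> + \<beta> \<bullet> x"
    using walk_certificate[where g = g, OF tf ps m on g0 order_refl] unfolding d_def by auto
  show ?thesis
  proof
    show "x \<in> frame_body m v" using x by (simp add: section_vertex_def)
    have "(\<Sum>k=1..d. q k * ((real m)\<^sup>2 / ((real m - real k) * (real m - real k + 1))))
        = (\<Sum>i=1..d. g i * (real m * real i / (real m - real i)))"
      unfolding abel[symmetric] using m by (intro sum.cong refl arg_cong2[of _ _ _ _ "(*)"] sum_gain_closed_form) (auto simp: d_def)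
    also have "\<dots> \<le> (\<Sum>i=1..d. g i * (\<Sum>k=1..i. (x \<bullet> u k)\<^sup>2))"
      using val minor[of x] by linarith
    also have "\<dots> = (\<Sum>k=1..d. q k * (x \<bullet> u k)\<^sup>2)" by (rule abel)
    finally show "(\<Sum>k=1..DIM('a). q k * ((real m)\<^sup>2 / ((real m - real k) * (real m - real k + 1))))
        \<le> (\<Sum>k=1..DIM('a). q k * (x \<bullet> u k)\<^sup>2)" by (simp only: d_def)
  qed
qed

section \<open>Lower bounds through \<open>eta\<close>\<close>

text \<open>
  With \<open>s = sqrt t\<close> the claim reads \<open>2 * ln s \<le> s - 1 / s\<close>; there is equality at \<open>s = 1\<close>, and the
  derivative of the difference is \<open>(1 - 1 / s)\<^sup>2\<close>.
\<close>

lemma ln_le_diff_div_sqrt: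
  fixes t :: real assumes "t \<ge> 1" shows "ln t \<le> (t - 1) / sqrt t"
proof -
  define f where "f s = s - 1 / s - 2 * ln s" for s :: real
  have "f 1 \<le> f (sqrt t)"
  proof (rule DERIV_nonneg_imp_nondecreasing[where f = f and a = 1 and b = "sqrt t"])
    show "1 \<le> sqrt t" using assms by simp
    fix s :: real assume s: "1 \<le> s" "s \<le> sqrt t"
    have "(f has_real_derivative (1 - 1 / s)\<^sup>2) (at s)"
      unfolding f_def using s
      by (auto intro!: derivative_eq_intros simp: power2_eq_square field_simps)
    then show "\<exists>y. (f has_real_derivative y) (at s) \<and> 0 \<le> y" by (intro exI[of _ "(1 - 1 / s)\<^sup>2"]) simp
  qed
  moreover have "ln t = 2 * ln (sqrt t)" using assms by (simp add: ln_sqrt)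
  ultimately have "ln t \<le> sqrt t - 1 / sqrt t" by (simp add: f_def)
  also have "\<dots> = (t - 1) / sqrt t" using assms by (simp add: field_simps)
  finally show ?thesis .
qed

text \<open>
  The logarithm telescopes into the terms \<open>ln ((m - k + 1) / (m - k))\<close>, each of which is bounded by the
  corresponding summand of \<open>eta\<close>.
\<close>

lemma eta_ge_ln:
  assumes "d < m" shows "real m * ln (real m / (real m - real d)) \<le> eta m d"
proof -
  have "ln (real m / (real m - real d)) \<le> (\<Sum>k=1..d. 1 / sqrt ((real m - real k) * (real m - real k + 1)))"
    using assms
  proof (induction d)
    case (Suc d)
    define N where "N = real m - real (Suc d)"
    have N: "N > 0" "real m - real d = N + 1" using Suc.prems by (auto simp: N_def)
    have "ln (real m / N) = ln (real m / (N + 1)) + ln ((N + 1) / N)"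
      using N Suc.prems by (simp add: ln_div)
    moreover have "ln ((N + 1) / N) \<le> 1 / sqrt (N * (N + 1))"
    proof -
      have cancel: "r * r * (b / r) = r * b" if "r \<noteq> 0" for r b :: real using that by simp
      have "ln ((N + 1) / N) \<le> ((N + 1) / N - 1) / sqrt ((N + 1) / N)"
        using N by (intro ln_le_diff_div_sqrt) (simp add: field_simps)
      also have "(N + 1) / N - 1 = 1 / N" using N by (simp add: field_simps)
      also have "1 / N / sqrt ((N + 1) / N) = 1 / (sqrt N * sqrt N * (sqrt (N + 1) / sqrt N))"
        using N by (simp add: real_sqrt_divide)
      also have "\<dots> = 1 / sqrt (N * (N + 1))"
        using cancel[of "sqrt N" "sqrt (N + 1)"] N by (simp only: real_sqrt_mult) simp
      finally show ?thesis .
    qed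
    ultimately have "ln (real m / N) \<le> (\<Sum>k=1..d. 1 / sqrt ((real m - real k) * (real m - real k + 1)))
        + 1 / sqrt (N * (N + 1))"
      using Suc.IH Suc.prems N(2) by simp
    then show ?case by (simp only: sum.cl_ivl_Suc N_def[symmetric]) simp
  qed simp
  then show ?thesis unfolding eta_def by (intro mult_left_mono) auto
qed

lemma eta_nonneg: "d < m \<Longrightarrow> eta m d \<ge> 0"
  by (auto simp: eta_def intro!: mult_nonneg_nonneg sum_nonneg)

text \<open>
  Cauchy--Schwarz for the vectors with entries \<open>sqrt (q k) * m / sqrt ((m - k) (m - k + 1))\<close> and
  \<open>1 / sqrt (q k)\<close>, whose inner product is \<open>eta m d\<close> whatever \<open>q\<close> is.
\<close>

lemma sum_mult_inverse_ge_eta_square: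
  fixes q :: "nat \<Rightarrow> real"
  assumes d: "d < m" and q: "\<And>k. k \<in> {1..d} \<Longrightarrow> q k > 0"
  shows "(eta m d)\<^sup>2 \<le> (\<Sum>k=1..d. q k * ((real m)\<^sup>2 / ((real m - real k) * (real m - real k + 1))))
                         * (\<Sum>k=1..d. 1 / q k)"
proof -
  define w where "w k = (real m - real k) * (real m - real k + 1)" for k :: nat
  have w: "w k > 0" if "k \<in> {1..d}" for k using that d by (simp add: w_def)
  have "eta m d = (\<Sum>k=1..d. (sqrt (q k) * (real m / sqrt (w k))) * sqrt (1 / q k))"
    unfolding eta_def sum_distrib_left w_def[symmetric]
  proof (intro sum.cong refl)
    fix k assume "k \<in> {1..d}"
    then show "real m * (1 / sqrt (w k)) = sqrt (q k) * (real m / sqrt (w k)) * sqrt (1 / q k)"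
      using q[of k] by (simp add: real_sqrt_divide)
  qed
  then have "(eta m d)\<^sup>2 \<le> (\<Sum>k=1..d. (sqrt (q k) * (real m / sqrt (w k)))\<^sup>2) * (\<Sum>k=1..d. (sqrt (1 / q k))\<^sup>2)"
    by (simp only: Cauchy_Schwarz_ineq_sum)
  also have "(\<Sum>k=1..d. (sqrt (q k) * (real m / sqrt (w k)))\<^sup>2) = (\<Sum>k=1..d. q k * ((real m)\<^sup>2 / w k))"
  proof (intro sum.cong refl)
    fix k assume "k \<in> {1..d}"
    then show "(sqrt (q k) * (real m / sqrt (w k)))\<^sup>2 = q k * ((real m)\<^sup>2 / w k)"
      using q[of k] w[of k] by (simp add: power_mult_distrib power_divide)
  qed
  also have "(\<Sum>k=1..d. (sqrt (1 / q k))\<^sup>2) = (\<Sum>k=1..d. 1 / q k)"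
    using q by (intro sum.cong refl real_sqrt_pow2) (simp add: less_imp_le)
  finally show ?thesis by (simp only: w_def)
qed

section \<open>Quadratic forms and traces in an eigenbasis\<close>

lemma linear_eq_on_orthonormal_basis:
  fixes f h :: "'a::euclidean_space \<Rightarrow> 'a"
  assumes on: "orthonormal_upto DIM('a) u" and "linear f" "linear h"
    and "\<And>i. i \<in> {1..DIM('a)} \<Longrightarrow> f (u i) = h (u i)"
  shows "f x = h x"
  by (rule linear_eq_on_span[OF assms(2,3) _ orthonormal_upto_basis_span[OF on]]) (use assms(4) in auto)

lemma linear_sum_scaleR_inner:
  fixes u w :: "nat \<Rightarrow> 'a::real_inner"
  shows "linear (\<lambda>x. \<Sum>k\<in>I. (c k * (x \<bullet> u k)) *\<^sub>R w k)"
  by (rule linearI)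
    (simp_all add: inner_add_left distrib_left scaleR_add_left sum.distrib scaleR_sum_right mult_ac)

lemma operator_trace_conv_sum_inner:
  fixes T :: "real ^ 'n \<Rightarrow> real ^ 'n"
  shows "operator_trace T = (\<Sum>i\<in>UNIV. T (axis i 1) \<bullet> axis i 1)"
  by (simp add: operator_trace_def trace_def matrix_def inner_axis)

lemma inner_self_conv_sum_axis:
  fixes x :: "real ^ 'n"
  shows "(\<Sum>i\<in>UNIV. (axis i 1 \<bullet> x) * (x \<bullet> axis i 1)) = x \<bullet> x"
proof -
  have "(\<Sum>i\<in>UNIV. (axis i 1 \<bullet> x) * (x \<bullet> axis i 1)) = (\<Sum>i\<in>UNIV. x $ i * x $ i)"
    by (simp add: inner_axis inner_axis')
  then show ?thesis by (simp add: inner_vec_def)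
qed

lemma operator_trace_sum_rank_one:
  fixes u w :: "nat \<Rightarrow> real ^ 'n"
  assumes "\<And>x. T x = (\<Sum>k\<in>I. (c k * (x \<bullet> u k)) *\<^sub>R u k)"
  shows "operator_trace T = (\<Sum>k\<in>I. c k * (u k \<bullet> u k))"
proof -
  have "operator_trace T = (\<Sum>i\<in>UNIV. \<Sum>k\<in>I. c k * ((axis i 1 \<bullet> u k) * (u k \<bullet> axis i 1)))"
    by (simp add: operator_trace_conv_sum_inner assms inner_sum_left mult.assoc)
  also have "\<dots> = (\<Sum>k\<in>I. c k * (\<Sum>i\<in>UNIV. (axis i 1 \<bullet> u k) * (u k \<bullet> axis i 1)))"
    unfolding sum_distrib_left by (rule sum.swap)
  also have "\<dots> = (\<Sum>k\<in>I. c k * (u k \<bullet> u k))" by (simp only: inner_self_conv_sum_axis)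
  finally show ?thesis .
qed

lemma eigenbasis_expand:
  fixes T :: "'a::euclidean_space \<Rightarrow> 'a"
  assumes on: "orthonormal_upto DIM('a) u" and lin: "linear T"
    and eig: "\<And>i. i \<in> {1..DIM('a)} \<Longrightarrow> T (u i) = c i *\<^sub>R u i"
  shows "T x = (\<Sum>k=1..DIM('a). (c k * (x \<bullet> u k)) *\<^sub>R u k)"
proof -
  have "T x = T (\<Sum>k=1..DIM('a). (x \<bullet> u k) *\<^sub>R u k)"
    using orthonormal_upto_span_expand[OF on orthonormal_upto_basis_span[OF on]] by simp
  also have "\<dots> = (\<Sum>k=1..DIM('a). (x \<bullet> u k) *\<^sub>R T (u k))"
    by (simp add: linear_sum[OF lin] linear_scale[OF lin])
  also have "\<dots> = (\<Sum>k=1..DIM('a). (c k * (x \<bullet> u k)) *\<^sub>R u k)"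
    by (intro sum.cong refl) (simp add: eig mult.commute)
  finally show ?thesis .
qed

lemma quadratic_form_eigenbasis:
  fixes T :: "'a::euclidean_space \<Rightarrow> 'a"
  assumes on: "orthonormal_upto DIM('a) u" and lin: "linear T"
    and eig: "\<And>i. i \<in> {1..DIM('a)} \<Longrightarrow> T (u i) = c i *\<^sub>R u i"
  shows "T x \<bullet> x = (\<Sum>k=1..DIM('a). c k * (x \<bullet> u k)\<^sup>2)"
  by (subst eigenbasis_expand[OF assms], assumption)
    (simp add: inner_sum_left inner_commute[of "u _" x] power2_eq_square mult.assoc)

lemma operator_trace_eigenbasis:
  fixes T :: "real ^ 'n \<Rightarrow> real ^ 'n"
  assumes on: "orthonormal_upto CARD('n) u" and lin: "linear T"
    and eig: "\<And>i. i \<in> {1..CARD('n)} \<Longrightarrow> T (u i) = c i *\<^sub>R u i"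
  shows "operator_trace T = (\<Sum>k=1..CARD('n). c k)"
proof -
  have "operator_trace T = (\<Sum>k=1..CARD('n). c k * (u k \<bullet> u k))"
    using eigenbasis_expand[of u T c] assms by (intro operator_trace_sum_rank_one) simp
  also have "\<dots> = (\<Sum>k=1..CARD('n). c k)"
    using on by (intro sum.cong) (auto simp: orthonormal_upto_def)
  finally show ?thesis .
qed

section \<open>Tight frames around the origin\<close>

lemma interior_hull_imp_positively_spanning:
  fixes v :: "nat \<Rightarrow> 'a::euclidean_space"
  assumes "0 \<in> interior (convex hull (v ` {1..m}))"
  shows "positively_spanning m v"
  unfolding positively_spanning_def
proof (intro allI impI, rule ccontr)
  fix a :: 'a assume a: "a \<noteq> 0" and "\<not> (\<exists>i\<in>{1..m}. 0 < v i \<bullet> a)"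
  then have "v ` {1..m} \<subseteq> {y. a \<bullet> y \<le> 0}" by (auto simp: inner_commute not_less)
  then have hull: "convex hull (v ` {1..m}) \<subseteq> {y. a \<bullet> y \<le> 0}"
    by (rule hull_minimal) (rule convex_halfspace_le)
  obtain e where e: "e > 0" "cball 0 e \<subseteq> convex hull (v ` {1..m})"
    using assms by (auto simp: mem_interior_cball)
  have "(e / norm a) *\<^sub>R a \<in> cball 0 e" using a e by simp
  then have "a \<bullet> ((e / norm a) *\<^sub>R a) \<le> 0" using e(2) hull by blast
  moreover have "e / norm a * (a \<bullet> a) > 0" using a e by (intro mult_pos_pos) auto
  ultimately show False by simp
qed

lemma frame_body_compact:
  fixes v :: "nat \<Rightarrow> 'a::euclidean_space"
  assumes "0 \<in> interior (convex hull (v ` {1..m}))"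
  shows "compact (frame_body m v)"
proof -
  have "frame_body m v = (\<Inter>i\<in>{1..m}. {x. v i \<bullet> x \<le> 1})" by (auto simp: frame_body_def)
  then have "closed (frame_body m v)" by (simp add: closed_INT closed_halfspace_le)
  moreover obtain e where e: "e > 0" "cball 0 e \<subseteq> convex hull (v ` {1..m})"
    using assms by (auto simp: mem_interior_cball)
  have "norm x \<le> 1 / e" if x: "x \<in> frame_body m v" for x
  proof (cases "x = 0")
    case False
    have "v ` {1..m} \<subseteq> {y. x \<bullet> y \<le> 1}" using x by (auto simp: frame_body_def inner_commute)
    then have hull: "convex hull (v ` {1..m}) \<subseteq> {y. x \<bullet> y \<le> 1}"
      by (rule hull_minimal) (rule convex_halfspace_le)
    have "(e / norm x) *\<^sub>R x \<in> cball 0 e" using False e by simp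
    then have "x \<bullet> ((e / norm x) *\<^sub>R x) \<le> 1" using e(2) hull by blast
    then show ?thesis using False e
      by (simp add: dot_square_norm power2_eq_square field_simps)
  qed (use e in simp)
  then have "bounded (frame_body m v)" by (auto simp: bounded_iff)
  ultimately show ?thesis by (simp add: compact_eq_bounded_closed)
qed

text \<open>
  With at most \<open>DIM('a)\<close> vectors some \<open>a \<noteq> 0\<close> is orthogonal to all differences \<open>v i - v 1\<close>.  Then all
  \<open>v i \<bullet> a\<close> are equal, so they cannot be positive somewhere both for \<open>a\<close> and for \<open>- a\<close>.
\<close>

lemma positively_spanning_dim_less:
  fixes v :: "nat \<Rightarrow> 'a::euclidean_space"
  assumes ps: "positively_spanning m v" shows "DIM('a) < m"
proof (rule ccontr)
  assume le: "\<not> DIM('a) < m"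
  have "m > 0"
  proof (rule ccontr)
    assume "\<not> m > 0"
    then have "{1..m} = {}" by simp
    moreover have "(SOME b. b \<in> Basis) \<noteq> (0 :: 'a)" by (intro nonzero_Basis SOME_Basis)
    ultimately show False using ps unfolding positively_spanning_def by blast
  qed
  have "\<exists>a. a \<noteq> 0 \<and> (\<forall>i\<in>{2..m}. (v i - v 1) \<bullet> a = 0)"
  proof (rule ccontr)
    assume "\<not> ?thesis"
    then have triv: "a = 0" if "\<And>i. i \<in> {2..m} \<Longrightarrow> (v i - v 1) \<bullet> a = 0" for a using that by blast
    have "dim (UNIV :: 'a set) \<le> card {2..m}"
      by (intro dim_le_card_if_annihilator_trivial[where v = "\<lambda>i. v i - v 1"] triv) auto
    then show False using le \<open>m > 0\<close> by (simp add: dim_UNIV)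
  qed
  then obtain a where a: "a \<noteq> 0" and eq: "\<And>i. i \<in> {2..m} \<Longrightarrow> v i \<bullet> a = v 1 \<bullet> a"
    by (auto simp: inner_diff_left)
  have eq': "v i \<bullet> a = v 1 \<bullet> a" if "i \<in> {1..m}" for i
    using eq[of i] that by (cases "i = 1") auto
  have pos: "\<exists>i\<in>{1..m}. v i \<bullet> b > 0" if "b \<noteq> 0" for b
    using ps that unfolding positively_spanning_def by blast
  obtain i where i: "i \<in> {1..m}" "v i \<bullet> a > 0" using pos[OF a] by blast
  obtain j where j: "j \<in> {1..m}" "v j \<bullet> (- a) > 0" using pos[of "- a"] a by auto
  show False using eq'[OF i(1)] eq'[OF j(1)] i(2) j(2) by simp
qed

text \<open>
  In an eigenbasis of \<open>Q\<close> the two factors are a diagonal form with the eigenvalues as coefficients and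
  the sum of their inverses.
\<close>

lemma quadratic_form_trace_inverse_bound:
  fixes v :: "nat \<Rightarrow> real ^ 'n" and Q :: "real ^ 'n \<Rightarrow> real ^ 'n"
  assumes tf: "tight_frame m v" and ps: "positively_spanning m v" and Q: "pos_def_operator Q"
  obtains x where "x \<in> frame_body m v" "(eta m CARD('n))\<^sup>2 \<le> (Q x \<bullet> x) * operator_trace (inv Q)"
    "operator_trace (inv Q) > 0"
proof -
  have lin: "linear Q" and adj: "adjoint Q = Q" and pos: "\<And>x. x \<noteq> 0 \<Longrightarrow> Q x \<bullet> x > 0"
    using Q by (auto simp: pos_def_operator_def)
  have sym: "Q x \<bullet> y = x \<bullet> Q y" for x y using adjoint_works[OF lin, of x y] adj by simp
  obtain u q where on: "orthonormal_upto DIM(real ^ 'n) u"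
    and eig: "\<And>i. i \<in> {1..DIM(real ^ 'n)} \<Longrightarrow> Q (u i) = q i *\<^sub>R u i"
    and dec: "\<And>i. 1 \<le> i \<Longrightarrow> i < DIM(real ^ 'n) \<Longrightarrow> q (Suc i) \<le> q i"
    using self_adjoint_sorted_eigenbasis[OF lin sym] by blast
  have qpos: "q i > 0" if i: "i \<in> {1..DIM(real ^ 'n)}" for i
  proof -
    have "u i \<bullet> u i = 1" using on i by (auto simp: orthonormal_upto_def)
    then have "u i \<noteq> 0" by auto
    from pos[OF this] show ?thesis using eig[OF i] \<open>u i \<bullet> u i = 1\<close> by simp
  qed
  have "x = 0" if "Q x = 0" for x using pos[of x] that by (cases "x = 0") auto
  then have inj: "inj Q" by (simp add: linear_injective_0[OF lin])
  have linv: "linear (inv Q)" by (rule inj_linear_imp_inv_linear[OF lin inj])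
  have "inv Q (u i) = (1 / q i) *\<^sub>R u i" if i: "i \<in> {1..CARD('n)}" for i
    using eig[of i] qpos[of i] i by (intro inv_f_eq[OF inj]) (simp add: linear_scale[OF lin])
  then have tr: "operator_trace (inv Q) = (\<Sum>k=1..CARD('n). 1 / q k)"
    using on by (intro operator_trace_eigenbasis[OF _ linv]) auto
  have m': "DIM(real ^ 'n) < m" by (rule positively_spanning_dim_less[OF ps])
  have card: "DIM(real ^ 'n) = CARD('n)" by simp
  have m: "CARD('n) < m" using m' by simp
  obtain x where x: "x \<in> frame_body m v"
    and le: "(\<Sum>k=1..CARD('n). q k * ((real m)\<^sup>2 / ((real m - real k) * (real m - real k + 1))))
        \<le> (\<Sum>k=1..CARD('n). q k * (x \<bullet> u k)\<^sup>2)"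
    using diagonal_form_lower_bound[where q = q, OF tf ps m' on dec less_imp_le[OF qpos]]
    unfolding card by blast
  have trpos: "operator_trace (inv Q) > 0"
    unfolding tr using qpos by (intro sum_pos) auto
  have "(eta m CARD('n))\<^sup>2 \<le> (\<Sum>k=1..CARD('n). q k * (x \<bullet> u k)\<^sup>2) * operator_trace (inv Q)"
    using order_trans[OF sum_mult_inverse_ge_eta_square[of "CARD('n)" m q]
        mult_right_mono[OF le, of "operator_trace (inv Q)", unfolded tr]] m qpos trpos
    unfolding tr by simp
  also have "(\<Sum>k=1..CARD('n). q k * (x \<bullet> u k)\<^sup>2) = Q x \<bullet> x"
    using quadratic_form_eigenbasis[OF on lin eig] by simp
  finally show ?thesis using that x trpos by blast
qed

section \<open>Intersections of halfspaces containing the unit ball\<close>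

text \<open>
  For a family that need not be tight, let \<open>T = (\<Sum>i=1..m. n i \<otimes> n i)\<close> and \<open>R = T\<^sup>-\<^sup>1\<^sup>/\<^sup>2\<close>.  The vectors
  \<open>R (n i)\<close> form a tight frame, and \<open>y = R x\<close> satisfies the constraints given by the \<open>n i\<close> exactly when
  \<open>x\<close> lies in the frame body.  Since \<open>\<parallel>y\<parallel>\<^sup>2\<close> is the quadratic form of \<open>Q = T\<^sup>-\<^sup>1\<close> at \<open>x\<close>, the bound for
  tight frames applies with \<open>trace Q\<^sup>-\<^sup>1 = trace T\<close>.
\<close>

lemma positively_spanning_tightening:
  fixes n :: "nat \<Rightarrow> real ^ 'n"
  assumes ps: "positively_spanning m n"
  obtains y where "\<And>i. i \<in> {1..m} \<Longrightarrow> n i \<bullet> y \<le> 1"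
    "(eta m CARD('n))\<^sup>2 \<le> (y \<bullet> y) * (\<Sum>i=1..m. n i \<bullet> n i)"
proof -
  define T where "T x = (\<Sum>i=1..m. (1 * (x \<bullet> n i)) *\<^sub>R n i)" for x
  have linT: "linear T" unfolding T_def by (rule linear_sum_scaleR_inner)
  have symT: "T x \<bullet> y = x \<bullet> T y" for x y
    by (simp add: T_def inner_sum_left inner_sum_right inner_commute mult.commute)
  have posT: "T x \<bullet> x > 0" if "x \<noteq> 0" for x
  proof -
    obtain j where j: "j \<in> {1..m}" "n j \<bullet> x > 0" using ps \<open>x \<noteq> 0\<close> by (auto simp: positively_spanning_def)
    have "T x \<bullet> x = (\<Sum>i=1..m. (n i \<bullet> x)\<^sup>2)"
      by (simp add: T_def inner_sum_left inner_commute[of "n _" x] power2_eq_square)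
    also have "\<dots> > 0" using j by (intro sum_pos2[of _ j]) auto
    finally show ?thesis .
  qed
  obtain u t where on: "orthonormal_upto DIM(real ^ 'n) u"
    and eig: "\<And>i. i \<in> {1..DIM(real ^ 'n)} \<Longrightarrow> T (u i) = t i *\<^sub>R u i"
    and "\<And>i. 1 \<le> i \<Longrightarrow> i < DIM(real ^ 'n) \<Longrightarrow> t (Suc i) \<le> t i"
    using self_adjoint_sorted_eigenbasis[OF linT symT] by blast
  have uu: "u i \<bullet> u k = (if i = k then 1 else 0)" if "i \<in> {1..DIM(real ^ 'n)}" "k \<in> {1..DIM(real ^ 'n)}" for i k
    using on that by (auto simp: orthonormal_upto_def)
  have tpos: "t i > 0" if i: "i \<in> {1..DIM(real ^ 'n)}" for i
  proof -
    have "u i \<noteq> 0" using uu[OF i i] by auto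
    from posT[OF this] show ?thesis using eig[OF i] uu[OF i i] by simp
  qed
  define r where "r k = 1 / sqrt (t k)" for k
  define R where "R x = (\<Sum>k=1..DIM(real ^ 'n). (r k * (x \<bullet> u k)) *\<^sub>R u k)" for x
  have linR: "linear R" unfolding R_def by (rule linear_sum_scaleR_inner)
  have symR: "R x \<bullet> y = x \<bullet> R y" for x y
    by (simp add: R_def inner_sum_left inner_sum_right inner_commute mult_ac)
  have Ru: "R (u i) = r i *\<^sub>R u i" if i: "i \<in> {1..DIM(real ^ 'n)}" for i
  proof -
    have "R (u i) = (\<Sum>k=1..DIM(real ^ 'n). if k = i then r i *\<^sub>R u i else 0)"
      unfolding R_def using i by (intro sum.cong) (auto simp: uu)
    then show ?thesis using i by simp
  qed
  have cancel: "r i * (t i * r i) = 1" "t i * (r i * r i) = 1" "r i * (r i * t i) = 1"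
    if "i \<in> {1..DIM(real ^ 'n)}" for i
    using tpos[OF that] by (simp_all add: r_def)
  note eigs = Ru eig linear_scale[OF linR] linear_scale[OF linT] cancel
  have "(R \<circ> T \<circ> R) x = id x" for x
    by (rule linear_eq_on_orthonormal_basis[OF on])
      (simp_all only: linear_compose linear_id linR linT, simp only: o_apply eigs id_apply scaleR_scaleR scaleR_one mult.assoc)
  then have RTR: "R (T (R x)) = x" for x by simp
  have "(T \<circ> R \<circ> R) x = id x" for x
    by (rule linear_eq_on_orthonormal_basis[OF on])
      (simp_all only: linear_compose linear_id linR linT, simp only: o_apply eigs id_apply scaleR_scaleR scaleR_one mult.assoc mult.commute[of "r _" "t _"])
  then have TRR: "T (R (R x)) = x" for x by simp
  have "(R \<circ> R \<circ> T) x = id x" for x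
    by (rule linear_eq_on_orthonormal_basis[OF on])
      (simp_all only: linear_compose linear_id linR linT, simp only: o_apply eigs id_apply scaleR_scaleR scaleR_one mult.assoc mult.commute[of "t _" "r _"])
  then have RRT: "R (R (T x)) = x" for x by simp
  have R0: "R x \<noteq> 0" if "x \<noteq> 0" for x
    using RTR[of x] that linear_0[OF linR] linear_0[OF linT] by auto
  define v where "v i = R (n i)" for i
  have tf: "tight_frame m v"
    unfolding tight_frame_def
  proof
    fix x
    have "(\<Sum>i=1..m. self_tensor (v i) x) = R (T (R x))"
      by (simp add: T_def linear_sum[OF linR] linear_scale[OF linR] self_tensor_def v_def symR inner_commute)
    then show "(\<Sum>i=1..m. self_tensor (v i) x) = id x" by (simp add: RTR)
  qed
  have ps': "positively_spanning m v"
    using ps R0 by (auto simp: positively_spanning_def v_def symR)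
  have pd: "pos_def_operator (\<lambda>x. R (R x))"
    unfolding pos_def_operator_def
  proof (intro conjI allI impI)
    show "linear (\<lambda>x. R (R x))" using linear_compose[OF linR linR] by (simp add: o_def)
    show "adjoint (\<lambda>x. R (R x)) = (\<lambda>x. R (R x))" by (rule adjoint_unique) (simp add: symR)
    fix x :: "real ^ 'n" assume "x \<noteq> 0"
    then have "R x \<bullet> R x > 0" using R0[of x] by simp
    then show "R (R x) \<bullet> x > 0" by (simp only: symR[of "R x" x])
  qed
  obtain x where x: "x \<in> frame_body m v"
    and le: "(eta m CARD('n))\<^sup>2 \<le> (R (R x) \<bullet> x) * operator_trace (inv (\<lambda>x. R (R x)))"
    using quadratic_form_trace_inverse_bound[OF tf ps' pd] by blast
  have "inv (\<lambda>x. R (R x)) = T" by (rule inv_unique_comp) (auto simp: fun_eq_iff TRR RRT)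
  moreover have "operator_trace T = (\<Sum>i=1..m. 1 * (n i \<bullet> n i))"
    by (rule operator_trace_sum_rank_one) (rule T_def)
  ultimately have "(eta m CARD('n))\<^sup>2 \<le> (R x \<bullet> R x) * (\<Sum>i=1..m. n i \<bullet> n i)"
    using le by (simp add: symR)
  moreover have "n i \<bullet> R x \<le> 1" if "i \<in> {1..m}" for i
    using x that by (simp add: frame_body_def v_def symR)
  ultimately show ?thesis using that by blast
qed

text \<open>
  If the unit normals do not span positively, the intersection contains a ray from \<open>0\<close> and hence points
  of every norm.
\<close>

lemma far_point_in_unit_halfspaces:
  fixes n :: "nat \<Rightarrow> real ^ 'n"
  assumes unit: "\<And>i. i \<in> {1..m} \<Longrightarrow> norm (n i) = 1" and m: "CARD('n) < m"
  obtains y where "\<And>i. i \<in> {1..m} \<Longrightarrow> n i \<bullet> y \<le> 1" "norm y \<ge> eta m CARD('n) / sqrt (real m)"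
proof (cases "positively_spanning m n")
  case True
  obtain y where y: "\<And>i. i \<in> {1..m} \<Longrightarrow> n i \<bullet> y \<le> 1"
    and le: "(eta m CARD('n))\<^sup>2 \<le> (y \<bullet> y) * (\<Sum>i=1..m. n i \<bullet> n i)"
    using positively_spanning_tightening[OF True] by blast
  have "(\<Sum>i=1..m. n i \<bullet> n i) = (\<Sum>i=1..m. 1)" using unit by (intro sum.cong) (auto simp: norm_eq_1)
  then have "(eta m CARD('n))\<^sup>2 \<le> (norm y * sqrt (real m))\<^sup>2"
    using le by (simp add: power_mult_distrib power2_norm_eq_inner)
  then have "eta m CARD('n) \<le> norm y * sqrt (real m)"
    by (rule power2_le_imp_le) simp
  then have "eta m CARD('n) / sqrt (real m) \<le> norm y" using m by (simp add: divide_le_eq)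
  then show ?thesis using y that by blast
next
  case False
  then obtain a where a: "a \<noteq> 0" "\<And>i. i \<in> {1..m} \<Longrightarrow> n i \<bullet> a \<le> 0"
    by (auto simp: positively_spanning_def not_less)
  define r where "r = eta m CARD('n) / sqrt (real m)"
  have r: "r \<ge> 0" using eta_nonneg[OF m] by (simp add: r_def)
  show ?thesis
  proof (rule that)
    show "n i \<bullet> ((r / norm a) *\<^sub>R a) \<le> 1" if "i \<in> {1..m}" for i
    proof -
      have "r / norm a * (n i \<bullet> a) \<le> 0" using a(2)[OF that] r by (intro mult_nonneg_nonpos) auto
      then show ?thesis by simp
    qed
    show "eta m CARD('n) / sqrt (real m) \<le> norm ((r / norm a) *\<^sub>R a)"
      using a(1) r by (simp add: r_def[symmetric])
  qed
qed

lemma closed_halfspace_contains_unit_halfspace: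
  fixes H :: "'a::real_inner set"
  assumes "closed_halfspace H" "cball 0 1 \<subseteq> H"
  obtains n where "norm n = 1" "{x. n \<bullet> x \<le> 1} \<subseteq> H"
proof -
  obtain a b where a: "a \<noteq> 0" and H: "H = {x. a \<bullet> x \<le> b}"
    using assms(1) by (auto simp: closed_halfspace_def)
  define n where "n = a /\<^sub>R norm a"
  have n: "norm n = 1" "a = norm a *\<^sub>R n" using a by (auto simp: n_def)
  have "n \<in> H" using assms(2) n(1) by auto
  then have "a \<bullet> n \<le> b" by (simp add: H)
  moreover have "a \<bullet> n = norm a" using a by (simp add: n_def dot_square_norm power2_eq_square)
  ultimately have b: "norm a \<le> b" by simp
  have "{x. n \<bullet> x \<le> 1} \<subseteq> H"
  proof
    fix x assume "x \<in> {x. n \<bullet> x \<le> 1}"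
    then have "norm a * (n \<bullet> x) \<le> norm a * 1" by (intro mult_left_mono) auto
    then have "a \<bullet> x \<le> norm a" using arg_cong[OF n(2), of "\<lambda>z. z \<bullet> x"] by simp
    then show "x \<in> H" using b by (simp add: H)
  qed
  then show ?thesis using that n(1) by blast
qed

lemma sqrt2_ln2_gt: "sqrt 2 * ln 2 > (0.98 :: real)"
proof -
  \<comment> \<open>the first three terms of \<open>ln 2 = 2 artanh (1 / 3)\<close>\<close>
  have "ln 2 \<ge> (0.693 :: real)"
    using ln_approx_bounds[of 2 3] by (simp add: eval_nat_numeral)
  moreover have "sqrt 2 > (1.4142 :: real)"
    by (rule real_less_rsqrt) (simp add: power2_eq_square)
  ultimately have "1.4142 * 0.693 \<le> sqrt 2 * (ln 2 :: real)" by (intro mult_mono) auto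
  then show ?thesis by simp
qed

theorem corollary6p1:
  shows "(\<forall>(m::nat) (v :: nat \<Rightarrow> real ^ 'n) (Q :: real ^ 'n \<Rightarrow> real ^ 'n).
            tight_frame m v \<longrightarrow>
            0 \<in> interior (convex hull (v ` {1..m})) \<longrightarrow>
            pos_def_operator Q \<longrightarrow>
              (\<exists>x\<in>frame_body m v. Q x \<bullet> x = max_quad_form (frame_body m v) Q \<and>
                 (\<forall>y\<in>frame_body m v. Q y \<bullet> y \<le> Q x \<bullet> x)) \<and>
              max_quad_form (frame_body m v) Q * operator_trace (inv Q) \<ge> (eta m CARD('n))\<^sup>2 \<and>
              (eta m CARD('n))\<^sup>2 \<ge>
                (real m)\<^sup>2 * (ln (real m / (real m - real CARD('n))))\<^sup>2 \<and>
              (m = 2 * CARD('n) \<longrightarrow>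
                 max_quad_form (frame_body m v) Q * operator_trace (inv Q)
                   \<ge> 4 * (ln 2)\<^sup>2 * (real CARD('n))\<^sup>2)) \<and>
         (\<forall>H :: nat \<Rightarrow> (real ^ 'n) set.
            (\<forall>i\<in>{1..2 * CARD('n)}. closed_halfspace (H i) \<and> cball 0 1 \<subseteq> H i) \<longrightarrow>
              (\<exists>x\<in>(\<Inter>i\<in>{1..2 * CARD('n)}. H i).
                 norm x \<ge> eta (2 * CARD('n)) CARD('n) / sqrt (2 * real CARD('n)))) \<and>
         eta (2 * CARD('n)) CARD('n) / sqrt (2 * real CARD('n))
           \<ge> sqrt 2 * ln 2 * sqrt (real CARD('n)) \<and>
         sqrt 2 * ln 2 * sqrt (real CARD('n)) > 0.98 * sqrt (real CARD('n))"
proof (intro conjI allI impI)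
  fix m :: nat and v :: "nat \<Rightarrow> real ^ 'n" and Q :: "real ^ 'n \<Rightarrow> real ^ 'n"
  assume tf: "tight_frame m v" and int: "0 \<in> interior (convex hull (v ` {1..m}))"
    and Q: "pos_def_operator Q"
  have ps: "positively_spanning m v" by (rule interior_hull_imp_positively_spanning[OF int])
  have m: "CARD('n) < m" using positively_spanning_dim_less[OF ps] by simp
  have lin: "linear Q" using Q by (simp add: pos_def_operator_def)
  have "frame_body m v \<noteq> {}" by (auto simp: frame_body_def intro: exI[of _ 0])
  moreover have "continuous_on (frame_body m v) (\<lambda>x. Q x \<bullet> x)"
    by (intro continuous_intros linear_continuous_on) (simp add: lin linear_conv_bounded_linear[symmetric])
  ultimately obtain x where x: "x \<in> frame_body m v"
    and max: "\<forall>y\<in>frame_body m v. Q y \<bullet> y \<le> Q x \<bullet> x"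
    using continuous_attains_sup[OF frame_body_compact[OF int]] by blast
  have S: "Q x \<bullet> x = max_quad_form (frame_body m v) Q"
    unfolding max_quad_form_def using x max by (intro cSup_eq_maximum[symmetric]) auto
  show "\<exists>x\<in>frame_body m v. Q x \<bullet> x = max_quad_form (frame_body m v) Q \<and>
                 (\<forall>y\<in>frame_body m v. Q y \<bullet> y \<le> Q x \<bullet> x)"
    using x S max by blast
  obtain z where z: "z \<in> frame_body m v"
    "(eta m CARD('n))\<^sup>2 \<le> (Q z \<bullet> z) * operator_trace (inv Q)" "operator_trace (inv Q) > 0"
    using quadratic_form_trace_inverse_bound[OF tf ps Q] .
  have "(Q z \<bullet> z) * operator_trace (inv Q) \<le> (Q x \<bullet> x) * operator_trace (inv Q)"
    using z max by (intro mult_right_mono) auto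
  then show main: "max_quad_form (frame_body m v) Q * operator_trace (inv Q) \<ge> (eta m CARD('n))\<^sup>2"
    using z(2) S by simp
  have "0 \<le> real m * ln (real m / (real m - real CARD('n)))"
    using m by (intro mult_nonneg_nonneg ln_ge_zero) auto
  from power_mono[OF eta_ge_ln[OF m] this, of 2]
  show eta: "(eta m CARD('n))\<^sup>2 \<ge> (real m)\<^sup>2 * (ln (real m / (real m - real CARD('n))))\<^sup>2"
    by (simp add: power_mult_distrib)
  assume "m = 2 * CARD('n)"
  then show "max_quad_form (frame_body m v) Q * operator_trace (inv Q)
                   \<ge> 4 * (ln 2)\<^sup>2 * (real CARD('n))\<^sup>2"
    using main eta by (simp add: power_mult_distrib mult_ac)
next
  fix H :: "nat \<Rightarrow> (real ^ 'n) set"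
  assume H: "\<forall>i\<in>{1..2 * CARD('n)}. closed_halfspace (H i) \<and> cball 0 1 \<subseteq> H i"
  have "\<forall>i\<in>{1..2 * CARD('n)}. \<exists>n. norm n = 1 \<and> {x. n \<bullet> x \<le> 1} \<subseteq> H i"
  proof
    fix i assume "i \<in> {1..2 * CARD('n)}"
    then have "closed_halfspace (H i)" "cball 0 1 \<subseteq> H i" using H by auto
    from closed_halfspace_contains_unit_halfspace[OF this]
    show "\<exists>n. norm n = 1 \<and> {x. n \<bullet> x \<le> 1} \<subseteq> H i" by blast
  qed
  from bchoice[OF this] obtain n
    where "\<forall>i\<in>{1..2 * CARD('n)}. norm (n i) = 1 \<and> {x. n i \<bullet> x \<le> 1} \<subseteq> H i" by blast
  then have n: "\<And>i. i \<in> {1..2 * CARD('n)} \<Longrightarrow> norm (n i) = 1"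
    and sub: "\<And>i. i \<in> {1..2 * CARD('n)} \<Longrightarrow> {x. n i \<bullet> x \<le> 1} \<subseteq> H i" by auto
  have "CARD('n) < 2 * CARD('n)" by simp
  then obtain y where y: "\<And>i. i \<in> {1..2 * CARD('n)} \<Longrightarrow> n i \<bullet> y \<le> 1"
    and far: "norm y \<ge> eta (2 * CARD('n)) CARD('n) / sqrt (real (2 * CARD('n)))"
    using far_point_in_unit_halfspaces[of "2 * CARD('n)" n, OF n] by blast
  have "y \<in> (\<Inter>i\<in>{1..2 * CARD('n)}. H i)" using y sub by blast
  then show "\<exists>x\<in>(\<Inter>i\<in>{1..2 * CARD('n)}. H i).
                 norm x \<ge> eta (2 * CARD('n)) CARD('n) / sqrt (2 * real CARD('n))"
    using far by (intro bexI[of _ y]) auto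
next
  define d where "d = real CARD('n)"
  have d: "d > 0" by (simp add: d_def)
  have "2 * d * ln (2 * d / (2 * d - d)) \<le> eta (2 * CARD('n)) CARD('n)"
    using eta_ge_ln[of "CARD('n)" "2 * CARD('n)"] by (simp add: d_def)
  moreover have "2 * d / (2 * d - d) = 2" using d by simp
  ultimately have ln: "2 * d * ln 2 \<le> eta (2 * CARD('n)) CARD('n)" by simp
  have "sqrt 2 * ln 2 * sqrt d * sqrt (2 * d) = (sqrt 2 * sqrt 2) * (sqrt d * sqrt d) * ln 2"
    by (simp only: real_sqrt_mult mult_ac)
  also have "\<dots> = 2 * d * ln 2" using d by simp
  also note ln
  finally have "sqrt 2 * ln 2 * sqrt d * sqrt (2 * d) \<le> eta (2 * CARD('n)) CARD('n)" .
  moreover have "sqrt (2 * d) > 0" using d by simp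
  ultimately have "sqrt 2 * ln 2 * sqrt d \<le> eta (2 * CARD('n)) CARD('n) / sqrt (2 * d)"
    by (simp only: pos_le_divide_eq)
  then show "eta (2 * CARD('n)) CARD('n) / sqrt (2 * real CARD('n))
           \<ge> sqrt 2 * ln 2 * sqrt (real CARD('n))" by (simp only: d_def)
  show "sqrt 2 * ln 2 * sqrt (real CARD('n)) > 0.98 * sqrt (real CARD('n))"
    using sqrt2_ln2_gt by (intro mult_strict_right_mono) auto
qed

end
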